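(* Let $\mu\in\mathbb{R}$, $\sigma>0$, $f_{\max}>0$ and $a\in\mathbb{R}$, and let $f(x;\mu,\sigma)=f_{\max}\,e^{-(x-\mu)^2/(2\sigma^2)}$. (i) If $M$ is the mean of $f$ over the interval $[a,\infty)$, with $a<M$, then the variance of $f$ over $[a,\infty)$ satisfies $\mathrm{Var}(x)_{|x\ge a}<(M-a)^2$. (ii) If $M$ is the mean of $f$ over the interval $(-\infty,a]$, with $a>M$, then the variance of $f$ over $(-\infty,a]$ satisfies $\mathrm{Var}(x)_{|x\le a}<(M-a)^2$.
   Context: For an interval $I=[a,\infty)$ or $I=(-\infty,a]$, the mean and variance of $f$ over $I$ are those of the truncated Gaussian distribution, i.e. of the probability density $f(x)\big/\int_I f(t)\,dt$ on $I$: the mean is $M=\int_I x f(x)\,dx\big/\int_I f(x)\,dx$ and the variance is $\int_I (x-M)^2 f(x)\,dx\big/\int_I f(x)\,dx$. These are denoted with the subscript $|x\ge a$ when $I=[a,\infty)$ and $|x\le a$ when $I=(-\infty,a]$. *)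

theory Defs
  imports "HOL-Analysis.Analysis"
begin

definition gauss :: "real \<Rightarrow> real \<Rightarrow> real \<Rightarrow> real \<Rightarrow> real" where
  "gauss fmax \<mu> \<sigma> x = fmax * exp (- ((x - \<mu>)^2 / (2 * \<sigma>^2)))"

text \<open>Mean and variance of the probability density obtained by normalizing \<open>f\<close> on \<open>I\<close>.
  They are meaningful only if \<open>f\<close>, \<open>x * f x\<close> and \<open>x^2 * f x\<close> are integrable
  on \<open>I\<close> and \<open>f\<close> has nonzero integral there.\<close>

definition mean_on :: "real set \<Rightarrow> (real \<Rightarrow> real) \<Rightarrow> real" where
  "mean_on I f = (LBINT x:I. x * f x) / (LBINT x:I. f x)"

definition variance_on :: "real set \<Rightarrow> (real \<Rightarrow> real) \<Rightarrow> real" where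
  "variance_on I f = (LBINT x:I. (x - mean_on I f)^2 * f x) / (LBINT x:I. f x)"

end

theory Submission
  imports Defs "HOL-Probability.Distributions"
begin

text \<open>
  Write \<open>\<theta> = M - a\<close> and compare the Gaussian \<open>f\<close> on \<open>[a, \<infinity>)\<close> with the exponential profile
  \<open>h x = c * exp (- (x - a) / \<theta>)\<close>, where \<open>c\<close> is chosen to give \<open>h\<close> the same total mass as \<open>f\<close>.
  Normalized, \<open>h\<close> has mean \<open>M\<close> and variance exactly \<open>\<theta>\<^sup>2\<close>, so the theorem says that \<open>f\<close> is
  strictly less spread out than the exponential distribution with the same mean.

  The reason is that \<open>f\<close> is strictly log-concave whereas \<open>ln h\<close> is affine: the logarithm
  \<open>q = ln (f / h)\<close> is a quadratic polynomial with negative leading coefficient \<open>- \<kappa>\<close>.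
  Since \<open>q\<close> and \<open>f - h\<close> always have the same sign, and \<open>q\<close> has at most two zeros, the integral of \<open>q * (f - h)\<close> is positive.
  But \<open>f\<close> and \<open>h\<close> agree in mass and first moment, so only the quadratic term of \<open>q\<close>
  contributes to that integral; what remains is \<open>- \<kappa>\<close> times the difference of the second moments.
  This is lemma \<open>second_moment_less_of_quadratic_log_ratio\<close>.
  The case of \<open>(-\<infinity>, a]\<close> follows by the reflection \<open>x \<mapsto> - x\<close>.
\<close>

section \<open>Comparing second moments\<close>

text \<open>
  The strictness of the theorem comes from here: finitely many zeros form a null set, which
  cannot exhaust \<open>S\<close>.
\<close>

lemma set_lborel_integral_pos:
  fixes g :: "real \<Rightarrow> real"
  assumes int: "set_integrable lborel S g"
    and S: "S \<in> sets lborel" "emeasure lborel S \<noteq> 0"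
    and nonneg: "\<And>x. x \<in> S \<Longrightarrow> 0 \<le> g x"
    and fin: "finite {x \<in> S. g x = 0}"
  shows "0 < (LBINT x:S. g x)"
proof -
  have ge: "0 \<le> indicator S x *\<^sub>R g x" for x
    using nonneg by (auto simp: indicator_def)
  have "(LBINT x:S. g x) \<noteq> 0"
  proof
    assume "(LBINT x:S. g x) = 0"
    then have *: "AE x in lborel. indicator S x *\<^sub>R g x = 0"
      using integral_nonneg_eq_0_iff_AE[of lborel "\<lambda>x. indicator S x *\<^sub>R g x"] int ge
      by (simp add: set_integrable_def set_lebesgue_integral_def)
    have "{x \<in> S. g x = 0} \<in> null_sets lborel"
      using fin by (rule finite_imp_null_set_lborel)
    then have "AE x in lborel. x \<notin> {x \<in> S. g x = 0}"
      by (rule AE_not_in)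
    with * have "AE x in lborel. x \<notin> S"
      by eventually_elim (auto simp: indicator_def split: if_splits)
    then have "S \<in> null_sets lborel"
      using S(1) by (simp add: AE_iff_null_sets)
    with S(2) show False by auto
  qed
  moreover have "0 \<le> (LBINT x:S. g x)"
    unfolding set_lebesgue_integral_def by (intro Bochner_Integration.integral_nonneg ge)
  ultimately show ?thesis by simp
qed

text \<open>
  The hypothesis on \<open>f\<close> says that \<open>ln (f / h)\<close> is the quadratic \<open>q\<close> of the opening remark.
  Integrating \<open>q * (f - h)\<close> instead of locating the sign changes of \<open>f - h\<close> avoids
  any case distinction on whether \<open>q\<close> has real roots.
\<close>

lemma second_moment_less_of_quadratic_log_ratio:
  fixes f h :: "real \<Rightarrow> real" and \<alpha> \<beta> \<kappa> c :: real
  assumes S: "S \<in> sets lborel" "emeasure lborel S \<noteq> 0"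
    and int_f: "\<And>i. i \<le> 2 \<Longrightarrow> set_integrable lborel S (\<lambda>x. (x - c) ^ i * f x)"
    and int_h: "\<And>i. i \<le> 2 \<Longrightarrow> set_integrable lborel S (\<lambda>x. (x - c) ^ i * h x)"
    and h_pos: "\<And>x. x \<in> S \<Longrightarrow> 0 < h x"
    and ratio: "\<And>x. x \<in> S \<Longrightarrow> f x = h x * exp (\<beta> + \<alpha> * (x - c) - \<kappa> * (x - c)\<^sup>2)"
    and \<kappa>: "0 < \<kappa>"
    and mass: "(LBINT x:S. f x) = (LBINT x:S. h x)"
    and mean: "(LBINT x:S. (x - c) * f x) = (LBINT x:S. (x - c) * h x)"
  shows "(LBINT x:S. (x - c)\<^sup>2 * f x) < (LBINT x:S. (x - c)\<^sup>2 * h x)"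
proof -
  define q where "q x = \<beta> + \<alpha> * (x - c) - \<kappa> * (x - c)\<^sup>2" for x
  define m where "m i x = (x - c) ^ i * f x - (x - c) ^ i * h x" for i x
  have int_m: "set_integrable lborel S (m i)" if "i \<le> 2" for i
    unfolding m_def using int_f int_h that by auto
  have m_eq: "(LBINT x:S. m i x)
      = (LBINT x:S. (x - c) ^ i * f x) - (LBINT x:S. (x - c) ^ i * h x)" if "i \<le> 2" for i
    unfolding m_def using int_f int_h that by (intro set_integral_diff) auto
  have expand: "q x * (f x - h x) = (\<beta> * m 0 x + \<alpha> * m 1 x) - \<kappa> * m 2 x" for x
    by (simp add: q_def m_def algebra_simps)
  have int0: "set_integrable lborel S (\<lambda>x. \<beta> * m 0 x)"
    and int1: "set_integrable lborel S (\<lambda>x. \<alpha> * m 1 x)"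
    and int2: "set_integrable lborel S (\<lambda>x. \<kappa> * m 2 x)"
    by (intro set_integrable_mult_right int_m; simp)+
  have int_q: "set_integrable lborel S (\<lambda>x. q x * (f x - h x))"
    unfolding expand by (intro set_integral_diff(1) set_integral_add(1) int0 int1 int2)
  have "0 < (LBINT x:S. q x * (f x - h x))"
  proof (rule set_lborel_integral_pos[OF int_q S])
    have diff: "f x - h x = h x * (exp (q x) - 1)" if "x \<in> S" for x
      using ratio[OF that] by (simp add: q_def algebra_simps)
    show "0 \<le> q x * (f x - h x)" if "x \<in> S" for x
      using h_pos[OF that] diff[OF that]
      by (cases "0 \<le> q x") (auto intro: mult_nonneg_nonneg mult_nonpos_nonpos simp: mult_le_0_iff)
    have "finite {x. poly [:\<beta> - \<alpha> * c - \<kappa> * c\<^sup>2, \<alpha> + 2 * \<kappa> * c, - \<kappa>:] x = 0}"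
      using \<kappa> by (intro poly_roots_finite) auto
    moreover have "poly [:\<beta> - \<alpha> * c - \<kappa> * c\<^sup>2, \<alpha> + 2 * \<kappa> * c, - \<kappa>:] x = q x" for x
      by (simp add: q_def power2_eq_square algebra_simps)
    ultimately have "finite {x. q x = 0}" by simp
    moreover have "{x \<in> S. q x * (f x - h x) = 0} \<subseteq> {x. q x = 0}"
      using h_pos diff by fastforce
    ultimately show "finite {x \<in> S. q x * (f x - h x) = 0}"
      by (rule rev_finite_subset)
  qed
  also have "(LBINT x:S. q x * (f x - h x)) =
      \<beta> * (LBINT x:S. m 0 x) + \<alpha> * (LBINT x:S. m 1 x) - \<kappa> * (LBINT x:S. m 2 x)"
    unfolding expand
    by (subst set_integral_diff(2)[OF set_integral_add(1)[OF int0 int1] int2],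
        subst set_integral_add(2)[OF int0 int1]) simp
  also have "\<dots> = - \<kappa> * (LBINT x:S. m 2 x)"
    using m_eq[of 0] m_eq[of 1] mass mean by simp
  finally have "(LBINT x:S. m 2 x) < 0"
    using \<kappa> by (simp add: mult_less_0_iff)
  then show ?thesis using m_eq[of 2] by simp
qed

section \<open>Moments of exponentials and Gaussians on a half-line\<close>

lemma exponential_half_line_moment:
  fixes a \<theta> :: real
  assumes \<theta>: "0 < \<theta>"
  shows "set_integrable lborel {a..} (\<lambda>x. (x - a) ^ i * exp (- ((x - a) / \<theta>)))" (is ?int)
    and "(LBINT x:{a..}. (x - a) ^ i * exp (- ((x - a) / \<theta>))) = fact i * \<theta> ^ Suc i" (is ?val)
proof -
  have "has_bochner_integral lborel (\<lambda>x. exponential_density (1 / \<theta>) x * x ^ i)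
      (fact i / (1 / \<theta>) ^ i)"
  proof (rule has_bochner_integral_nn_integral)
    show "(\<integral>\<^sup>+ x. ennreal (exponential_density (1 / \<theta>) x * x ^ i) \<partial>lborel)
        = ennreal (fact i / (1 / \<theta>) ^ i)"
      using nn_integral_erlang_ith_moment[of "1 / \<theta>" 0 i] \<theta> by simp
  qed (use \<theta> in \<open>auto simp: exponential_density_def\<close>)
  from has_bochner_integral_mult_right[OF this, of \<theta>]
  have "has_bochner_integral lborel (\<lambda>x. indicator {0..} x *\<^sub>R (x ^ i * exp (- (x / \<theta>))))
      (fact i * \<theta> ^ Suc i)"
    by (rule has_bochner_integral_cong[THEN iffD1, rotated -1])
      (use \<theta> in \<open>auto simp: exponential_density_def indicator_def power_divide\<close>)
  then have "has_bochner_integral lborel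
      (\<lambda>x. indicator {0..} (- a + 1 * x) *\<^sub>R ((- a + 1 * x) ^ i * exp (- ((- a + 1 * x) / \<theta>))))
      (fact i * \<theta> ^ Suc i)"
    by (subst (asm) lborel_has_bochner_integral_real_affine_iff[where c = 1 and t = "- a"])
      simp_all
  then have "has_bochner_integral lborel
      (\<lambda>x. indicator {a..} x *\<^sub>R ((x - a) ^ i * exp (- ((x - a) / \<theta>)))) (fact i * \<theta> ^ Suc i)"
    by (rule has_bochner_integral_cong[THEN iffD1, rotated -1]) (auto simp: indicator_def)
  then show ?int ?val
    unfolding set_integrable_def set_lebesgue_integral_def
    by (auto simp: has_bochner_integral_iff)
qed

lemma gauss_moment_integrable:
  assumes "0 < \<sigma>" "S \<in> sets lborel" "i \<le> 2"
  shows "set_integrable lborel S (\<lambda>x. (x - c) ^ i * gauss fmax \<mu> \<sigma> x)"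
proof -
  let ?n = "\<lambda>k x. normal_density \<mu> \<sigma> x * (x - \<mu>) ^ k"
  let ?d = "\<mu> - c"
  have gauss: "gauss fmax \<mu> \<sigma> x = fmax * sqrt (2 * pi * \<sigma>\<^sup>2) * normal_density \<mu> \<sigma> x" for x
    using assms(1) by (simp add: gauss_def normal_density_def)
  have "integrable lborel (?n k)" for k
    using assms(1) by (rule integrable_normal_moment)
  then have n: "set_integrable lborel S (?n k)" for k
    unfolding set_integrable_def using assms(2) by (intro integrable_mult_indicator)
  have "set_integrable lborel S (\<lambda>x. normal_density \<mu> \<sigma> x * (x - c) ^ i)"
  proof -
    consider "i = 0" | "i = 1" | "i = 2" using assms(3) by linarith
    then show ?thesis
    proof cases
      case 1
      then show ?thesis using n[of 0] by simp
    next
      case 2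
      have "set_integrable lborel S (\<lambda>x. ?n 1 x + ?d * ?n 0 x)"
        by (intro set_integral_add(1) set_integrable_mult_right n)
      then show ?thesis using 2 by (simp add: algebra_simps)
    next
      case 3
      have "set_integrable lborel S (\<lambda>x. ?n 2 x + ((2 * ?d) * ?n 1 x + ?d\<^sup>2 * ?n 0 x))"
        by (intro set_integral_add(1) set_integrable_mult_right n)
      then show ?thesis using 3 by (simp add: algebra_simps power2_eq_square)
    qed
  qed
  from set_integrable_mult_right[OF this, of "fmax * sqrt (2 * pi * \<sigma>\<^sup>2)"]
  show ?thesis by (simp add: gauss ac_simps)
qed

section \<open>Truncated Gaussians\<close>

lemma variance_gauss_atLeast_less:
  assumes \<sigma>: "0 < \<sigma>" and fmax: "0 < fmax"
    and less: "a < mean_on {a..} (gauss fmax \<mu> \<sigma>)"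
  shows "variance_on {a..} (gauss fmax \<mu> \<sigma>) < (mean_on {a..} (gauss fmax \<mu> \<sigma>) - a)\<^sup>2"
proof -
  define f where "f = gauss fmax \<mu> \<sigma>"
  define M where "M = mean_on {a..} f"
  define \<theta> where "\<theta> = M - a"
  define A where "A = (LBINT x:{a..}. f x)"
  define h where "h x = A / \<theta> * exp (- ((x - a) / \<theta>))" for x
  have \<theta>: "0 < \<theta>" using less by (simp add: \<theta>_def M_def f_def)
  have f_pos: "0 < f x" for x using fmax by (simp add: f_def gauss_def)
  have S: "{a..} \<in> sets lborel" "emeasure lborel {a..} \<noteq> 0"
    using emeasure_mono[of "{a..a + 1}" "{a..}" lborel] by auto
  have int_f: "set_integrable lborel {a..} (\<lambda>x. (x - c) ^ i * f x)" if "i \<le> 2" for i c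
    unfolding f_def using \<sigma> S(1) that by (rule gauss_moment_integrable)
  \<comment> \<open>If \<open>A\<close> were zero, \<open>M\<close> would be zero by the convention for division by zero, and
    \<open>M * A\<close> would carry no information about the first moment.\<close>
  have A: "0 < A"
    unfolding A_def
  proof (rule set_lborel_integral_pos[OF _ S])
    show "set_integrable lborel {a..} f" using int_f[of 0] by simp
    show "0 \<le> f x" for x using f_pos[of x] by simp
    have "f x \<noteq> 0" for x using f_pos[of x] by simp
    then show "finite {x \<in> {a..}. f x = 0}" by simp
  qed

  have h_eq: "(x - a) ^ i * h x = A / \<theta> * ((x - a) ^ i * exp (- ((x - a) / \<theta>)))" for i x
    by (simp add: h_def)
  have int_h: "set_integrable lborel {a..} (\<lambda>x. (x - a) ^ i * h x)" for i
    unfolding h_eq by (intro set_integrable_mult_right exponential_half_line_moment(1) \<theta>)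
  have moment_h: "(LBINT x:{a..}. (x - a) ^ i * h x) = A * fact i * \<theta> ^ i" for i
    unfolding h_eq set_integral_mult_right exponential_half_line_moment(2)[OF \<theta>]
    using \<theta> by simp

  have "(LBINT x:{a..}. x * f x) = M * A"
    using A by (simp add: M_def mean_on_def A_def)
  moreover have "(LBINT x:{a..}. (x - a) * f x) = (LBINT x:{a..}. x * f x) - a * A"
    using set_integral_diff(2)[of lborel "{a..}" "\<lambda>x. x * f x" "\<lambda>x. a * f x"]
      int_f[of 1 0] int_f[of 0] by (simp add: A_def algebra_simps)
  ultimately have first: "(LBINT x:{a..}. (x - a) * f x) = A * \<theta>"
    by (simp add: \<theta>_def algebra_simps)

  have second: "(LBINT x:{a..}. (x - a)\<^sup>2 * f x) < (LBINT x:{a..}. (x - a)\<^sup>2 * h x)"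
  proof (rule second_moment_less_of_quadratic_log_ratio[OF S int_f int_h])
    show "0 < h x" for x using A \<theta> by (simp add: h_def)
    show "0 < 1 / (2 * \<sigma>\<^sup>2)" using \<sigma> by simp
    show "(LBINT x:{a..}. f x) = (LBINT x:{a..}. h x)"
      using moment_h[of 0] by (simp add: A_def)
    show "(LBINT x:{a..}. (x - a) * f x) = (LBINT x:{a..}. (x - a) * h x)"
      using moment_h[of 1] first by simp
    show "f x = h x * exp (ln (fmax * \<theta> / A) - (a - \<mu>)\<^sup>2 / (2 * \<sigma>\<^sup>2)
        + (1 / \<theta> - (a - \<mu>) / \<sigma>\<^sup>2) * (x - a) - 1 / (2 * \<sigma>\<^sup>2) * (x - a)\<^sup>2)" for x
    proof -
      \<comment> \<open>\<open>ln f\<close> expanded in powers of \<open>x - a\<close>; its quadratic coefficient survives division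
        by \<open>h\<close> because \<open>ln h\<close> is affine.\<close>
      have "- ((x - \<mu>)\<^sup>2 / (2 * \<sigma>\<^sup>2)) = - ((a - \<mu>)\<^sup>2 / (2 * \<sigma>\<^sup>2))
          - (a - \<mu>) / \<sigma>\<^sup>2 * (x - a) - 1 / (2 * \<sigma>\<^sup>2) * (x - a)\<^sup>2"
        using \<sigma> by (simp add: field_simps power2_eq_square)
      then have "ln (fmax * \<theta> / A) - (a - \<mu>)\<^sup>2 / (2 * \<sigma>\<^sup>2)
          + (1 / \<theta> - (a - \<mu>) / \<sigma>\<^sup>2) * (x - a) - 1 / (2 * \<sigma>\<^sup>2) * (x - a)\<^sup>2
          = ln (fmax * \<theta> / A) + (x - a) / \<theta> + - ((x - \<mu>)\<^sup>2 / (2 * \<sigma>\<^sup>2))"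
        by (simp add: left_diff_distrib)
      moreover have "exp (ln (fmax * \<theta> / A)) = fmax * \<theta> / A"
        using fmax \<theta> A by simp
      ultimately show ?thesis
        using \<theta> A by (simp only: exp_add) (simp add: f_def gauss_def h_def exp_minus)
    qed
  qed

  \<comment> \<open>The second moment of \<open>h\<close> about \<open>a\<close> is \<open>2 * A * \<theta>\<^sup>2\<close>; passing from \<open>a\<close> to \<open>M\<close> subtracts \<open>A * \<theta>\<^sup>2\<close>.\<close>
  have "(x - M)\<^sup>2 * f x = (x - a)\<^sup>2 * f x - (2 * \<theta> * ((x - a) * f x) - \<theta>\<^sup>2 * f x)" for x
    by (simp add: \<theta>_def power2_eq_square algebra_simps)
  then have "(LBINT x:{a..}. (x - M)\<^sup>2 * f x)
      = (LBINT x:{a..}. (x - a)\<^sup>2 * f x - (2 * \<theta> * ((x - a) * f x) - \<theta>\<^sup>2 * f x))"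
    by simp
  also have "\<dots> = (LBINT x:{a..}. (x - a)\<^sup>2 * f x)
      - (2 * \<theta> * (LBINT x:{a..}. (x - a) * f x) - \<theta>\<^sup>2 * A)"
    using int_f[of 0 a] int_f[of 1 a] int_f[of 2 a]
    by (simp add: set_integral_diff A_def)
  also have "\<dots> < A * fact 2 * \<theta>\<^sup>2 - (2 * \<theta> * (A * \<theta>) - \<theta>\<^sup>2 * A)"
    using second moment_h[of 2] first by simp
  also have "\<dots> = \<theta>\<^sup>2 * A"
    by (simp add: power2_eq_square)
  finally have "variance_on {a..} f < \<theta>\<^sup>2"
    using A by (simp add: variance_on_def M_def[symmetric] A_def[symmetric] divide_less_eq)
  then show ?thesis by (simp add: \<theta>_def M_def f_def)
qed

lemma mean_on_reflect:
  "mean_on {..a} f = - mean_on {- a..} (\<lambda>x. f (- x))" for a :: real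
proof -
  have "{x. - x \<le> a} = {- a..}" by auto
  moreover have "(LBINT x:{- a..}. - x * f (- x)) = - (LBINT x:{- a..}. x * f (- x))"
    using set_integral_mult_right[of lborel "{- a..}" "- 1" "\<lambda>x. x * f (- x)"] by simp
  ultimately show ?thesis
    by (simp add: mean_on_def set_integral_reflect[of "{..a}"])
qed

lemma variance_on_reflect:
  "variance_on {..a} f = variance_on {- a..} (\<lambda>x. f (- x))" for a :: real
proof -
  have "{x. - x \<le> a} = {- a..}" by auto
  moreover have "(- x - - m)\<^sup>2 = (x - m)\<^sup>2" for x m :: real
    by (simp add: power2_commute)
  ultimately show ?thesis
    unfolding variance_on_def mean_on_reflect by (simp add: set_integral_reflect[of "{..a}"])
qed

lemma gauss_reflect: "gauss fmax \<mu> \<sigma> (- x) = gauss fmax (- \<mu>) \<sigma> x"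
proof -
  have "(- x - \<mu>)\<^sup>2 = (x - - \<mu>)\<^sup>2" by (simp add: power2_eq_square algebra_simps)
  then show ?thesis by (simp add: gauss_def)
qed

theorem theorem2p7:
  fixes \<mu> \<sigma> fmax a :: real
  assumes "\<sigma> > 0" and "fmax > 0"
  shows "(\<forall>M. M = mean_on {a..} (gauss fmax \<mu> \<sigma>) \<and> a < M \<longrightarrow>
            variance_on {a..} (gauss fmax \<mu> \<sigma>) < (M - a)^2) \<and>
         (\<forall>M. M = mean_on {..a} (gauss fmax \<mu> \<sigma>) \<and> a > M \<longrightarrow>
            variance_on {..a} (gauss fmax \<mu> \<sigma>) < (M - a)^2)"
proof (intro conjI allI impI; elim conjE)
  fix M
  assume "M = mean_on {a..} (gauss fmax \<mu> \<sigma>)" "a < M"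
  then show "variance_on {a..} (gauss fmax \<mu> \<sigma>) < (M - a)^2"
    using variance_gauss_atLeast_less[OF assms] by simp
next
  fix M
  assume M: "M = mean_on {..a} (gauss fmax \<mu> \<sigma>)" "M < a"
  then have "M = - mean_on {- a..} (gauss fmax (- \<mu>) \<sigma>)"
    by (simp add: mean_on_reflect gauss_reflect)
  moreover from this M have "variance_on {..a} (gauss fmax \<mu> \<sigma>) < (- M - - a)\<^sup>2"
    using variance_gauss_atLeast_less[OF assms, of "- a" "- \<mu>"]
    by (simp add: variance_on_reflect gauss_reflect)
  moreover have "(- M - - a)\<^sup>2 = (M - a)\<^sup>2"
    by (simp add: power2_commute)
  ultimately show "variance_on {..a} (gauss fmax \<mu> \<sigma>) < (M - a)^2"
    by metis
qed

end
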